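(* For any $2n\times2n$ complex orthogonal matrix $O$, there exist a $2n\times2n$ real orthogonal matrix $U$, an $n\times n$ quaternionic orthogonal matrix $V\in\mathbb{H}^{n\times n}$ such that $V^{D_j}V=I_n$, and $n$ unique (up to order and signs) real numbers $\theta_1,\dots,\theta_n$ such that $$O=U\begin{bmatrix}Ch&iSh\\-iSh&Ch\end{bmatrix}[V]_{\mathbb{C}}.$$
   Context: A complex orthogonal matrix is $O\in\mathbb{C}^{2n\times2n}$ with $O^TO=I_{2n}$ ($^T$ the ordinary, non-conjugate transpose). $\mathbb{H}$ denotes the real quaternions with imaginary units $i,j,k$; for $M\in\mathbb{H}^{n\times n}$, $(M^D)_{ab}=\overline{M_{ba}}$ and $M^{D_j}=-jM^Dj$. The complexify map sends $Y=Y_0+iY_1+jY_2+kY_3$ (with $Y_0,\dots,Y_3$ real matrices) to $$[Y]_{\mathbb{C}}=\begin{bmatrix} Y_0+iY_1 & Y_2+iY_3\\ -Y_2+iY_3 & Y_0-iY_1\end{bmatrix}.$$ $Ch=\operatorname{diag}(\cosh\theta_1,\dots,\cosh\theta_n)$ and $Sh=\operatorname{diag}(\sinh\theta_1,\dots,\sinh\theta_n)$. *)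

theory Defs
  imports
    Complex_Main
    "HOL-Combinatorics.Permutations"
    "Jordan_Normal_Form.Matrix"
begin

section \<open>Real quaternions\<close>

text \<open>The quaternion with components \<open>a\<close>, \<open>b\<close>, \<open>c\<close>, \<open>d\<close> is \<open>a + b i + c j + d k\<close>.\<close>

datatype quat = Quat (qRe: real) (qI: real) (qJ: real) (qK: real)

lemma quat_eq_iff: "x = y \<longleftrightarrow> qRe x = qRe y \<and> qI x = qI y \<and> qJ x = qJ y \<and> qK x = qK y"
  by (cases x; cases y) auto

instantiation quat :: ring_1
begin

definition "0 = Quat 0 0 0 0"

definition "1 = Quat 1 0 0 0"

definition "- x = Quat (- qRe x) (- qI x) (- qJ x) (- qK x)"

definition "x + y = Quat (qRe x + qRe y) (qI x + qI y) (qJ x + qJ y) (qK x + qK y)"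

definition "x - y = Quat (qRe x - qRe y) (qI x - qI y) (qJ x - qJ y) (qK x - qK y)"

definition "x * y = Quat
  (qRe x * qRe y - qI x * qI y - qJ x * qJ y - qK x * qK y)
  (qRe x * qI y + qI x * qRe y + qJ x * qK y - qK x * qJ y)
  (qRe x * qJ y - qI x * qK y + qJ x * qRe y + qK x * qI y)
  (qRe x * qK y + qI x * qJ y - qJ x * qI y + qK x * qRe y)"

instance
  by standard
    (simp_all add: quat_eq_iff zero_quat_def one_quat_def uminus_quat_def plus_quat_def
      minus_quat_def times_quat_def algebra_simps)

end

definition quat_i :: quat where "quat_i = Quat 0 1 0 0"

definition quat_j :: quat where "quat_j = Quat 0 0 1 0"

definition quat_k :: quat where "quat_k = Quat 0 0 0 1"

lemma quat_units:
  "quat_i * quat_i = - 1" "quat_j * quat_j = - 1" "quat_k * quat_k = - 1"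
  "quat_i * quat_j * quat_k = - 1"
  by (simp_all add: quat_eq_iff quat_i_def quat_j_def quat_k_def one_quat_def uminus_quat_def
      times_quat_def)

definition quat_cnj :: "quat \<Rightarrow> quat" where
  "quat_cnj x = Quat (qRe x) (- qI x) (- qJ x) (- qK x)"


section \<open>Quaternionic matrices\<close>

definition quat_adjoint :: "quat mat \<Rightarrow> quat mat" where
  "quat_adjoint M = map_mat quat_cnj (transpose_mat M)"

text \<open>\<open>- j M\<^sup>D j\<close>, where left and right multiplication by the scalar \<open>j\<close> act entrywise.\<close>

definition quat_adjoint_j :: "quat mat \<Rightarrow> quat mat" where
  "quat_adjoint_j M = map_mat (\<lambda>x. - (quat_j * x * quat_j)) (quat_adjoint M)"

definition complexify :: "quat mat \<Rightarrow> complex mat" where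
  "complexify Y = four_block_mat
     (map_mat (\<lambda>y. Complex (qRe y) (qI y)) Y)   (map_mat (\<lambda>y. Complex (qJ y) (qK y)) Y)
     (map_mat (\<lambda>y. Complex (- qJ y) (qK y)) Y)  (map_mat (\<lambda>y. Complex (qRe y) (- qI y)) Y)"

definition quat_orthogonal :: "nat \<Rightarrow> quat mat \<Rightarrow> bool" where
  "quat_orthogonal n V \<longleftrightarrow> V \<in> carrier_mat n n \<and> quat_adjoint_j V * V = 1\<^sub>m n"


section \<open>Real and complex orthogonal matrices\<close>

text \<open>The predicate \<^const>\<open>orthogonal_mat\<close> of the matrix library only asks for nonzero,
  pairwise orthogonal columns; here the columns are normalised as well.\<close>

definition orthonormal_mat :: "nat \<Rightarrow> 'a :: comm_ring_1 mat \<Rightarrow> bool" where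
  "orthonormal_mat m A \<longleftrightarrow> A \<in> carrier_mat m m \<and> transpose_mat A * A = 1\<^sub>m m"

definition hyperbolic_mat :: "nat \<Rightarrow> (nat \<Rightarrow> real) \<Rightarrow> complex mat" where
  "hyperbolic_mat n \<theta> =
     (let Ch = mat_diag n (\<lambda>m. complex_of_real (cosh (\<theta> m)));
          Sh = mat_diag n (\<lambda>m. complex_of_real (sinh (\<theta> m)))
      in four_block_mat Ch (\<i> \<cdot>\<^sub>m Sh) ((- \<i>) \<cdot>\<^sub>m Sh) Ch)"

text \<open>In a tuple \<open>\<theta>\<close> of \<open>n\<close> angles, only \<open>\<theta> 0, \<dots>, \<theta> (n - 1)\<close> matter.\<close>

definition orthogonal_factorization ::
  "nat \<Rightarrow> complex mat \<Rightarrow> real mat \<Rightarrow> (nat \<Rightarrow> real) \<Rightarrow> quat mat \<Rightarrow> bool" where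
  "orthogonal_factorization n A U \<theta> V \<longleftrightarrow>
     orthonormal_mat (2 * n) U \<and> quat_orthogonal n V \<and>
     A = map_mat complex_of_real U * hyperbolic_mat n \<theta> * complexify V"

end

theory Submission
  imports Defs "Jordan_Normal_Form.Schur_Decomposition"
begin

text \<open>
  Let \<open>J\<close> be the matrix of the quaternion unit \<open>j\<close>. Complexified quaternionic matrices are those \<open>W\<close>
  with \<open>cnj W J = J W\<close>, and the hyperbolic matrix is \<open>exp (\<i> \<Theta> J)\<close>. A factorization \<open>A = U H V\<close> is
  therefore equivalent to a real orthogonal normal form \<open>M = U (J H\<^sup>-\<^sup>2) U\<^sup>T\<close> of
  \<open>M = cnj A J A\<^sup>T\<close>, in which \<open>V\<close> no longer occurs. The spectrum of \<open>J H\<^sup>-\<^sup>2\<close> consists of the numbers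
  \<open>\<i> exp (2 \<theta>)\<close> and \<open>- \<i> exp (- 2 \<theta>)\<close>, so the characteristic polynomial of \<open>M\<close> determines the
  angles. Conversely \<open>M\<close> is skew-Hermitian with \<open>M cnj M = - 1\<close>: conjugation sends its
  \<open>\<i> \<mu>\<close>-eigenvectors to \<open>- \<i> / \<mu>\<close>-eigenvectors, and \<open>\<surd>2\<close> times the real and imaginary parts of
  an orthonormal basis of eigenvectors with \<open>\<mu> > 0\<close> form the columns of \<open>U\<close>.
\<close>

section \<open>Entrywise conjugation, real matrices and cancellation in products\<close>

abbreviation cnj_mat :: "complex mat \<Rightarrow> complex mat" where
  "cnj_mat \<equiv> map_mat cnj"

lemma cnj_mat_mult:
  "A \<in> carrier_mat m k \<Longrightarrow> B \<in> carrier_mat k l \<Longrightarrow> cnj_mat (A * B) = cnj_mat A * cnj_mat B"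
  by (rule eq_matI) (auto simp: scalar_prod_def)

lemma cnj_mat_cnj_mat [simp]: "cnj_mat (cnj_mat A) = A"
  by (rule eq_matI) auto

lemma cnj_mat_one [simp]: "cnj_mat (1\<^sub>m n) = 1\<^sub>m n"
  by (rule eq_matI) auto

lemma cnj_mat_of_real [simp]: "cnj_mat (map_mat complex_of_real A) = map_mat complex_of_real A"
  by (rule eq_matI) auto

lemma of_real_mat_mult:
  "A \<in> carrier_mat m k \<Longrightarrow> B \<in> carrier_mat k l \<Longrightarrow>
    map_mat complex_of_real (A * B) = map_mat complex_of_real A * map_mat complex_of_real B"
  by (rule eq_matI) (auto simp: scalar_prod_def)

lemma real_mat_obtain:
  assumes "cnj_mat A = A"
  obtains B where "A = map_mat complex_of_real B"
proof
  have "A $$ (i, j) \<in> \<real>" if "i < dim_row A" "j < dim_col A" for i j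
    using arg_cong[OF assms, of "\<lambda>X. X $$ (i, j)"] that by (simp add: Reals_cnj_iff)
  then show "A = map_mat complex_of_real (map_mat Re A)"
    by (intro eq_matI) (auto simp: of_real_Re)
qed

lemma square_mult_carrier [simp]:
  "A \<in> carrier_mat k k \<Longrightarrow> B \<in> carrier_mat k k \<Longrightarrow> A * B \<in> carrier_mat k k"
  by (rule mult_carrier_mat)

text \<open>Long products are kept associated to the right below; in this form an inverse pair
  cancels inside such a product by rewriting.\<close>

lemma mult_cancel_left_inverse:
  fixes A :: "'a :: comm_ring_1 mat"
  assumes "A * B = 1\<^sub>m k" "A \<in> carrier_mat k k" "B \<in> carrier_mat k k" "X \<in> carrier_mat k k"
  shows "A * (B * X) = X"
  using assms by (simp flip: assoc_mult_mat[of A k k B k X k])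

section \<open>Two-by-two blocks of diagonal matrices\<close>

text \<open>Such a matrix is \<open>n\<close> independent two-by-two matrices, the
  \<open>i\<close>-th acting on the coordinates \<open>i\<close> and \<open>i + n\<close>, so
  identities between products reduce to scalar ones for each index.\<close>

definition diag_blocks ::
  "nat \<Rightarrow> (nat \<Rightarrow> 'a) \<Rightarrow> (nat \<Rightarrow> 'a) \<Rightarrow> (nat \<Rightarrow> 'a) \<Rightarrow> (nat \<Rightarrow> 'a) \<Rightarrow> 'a :: zero mat" where
  "diag_blocks n a b c d = four_block_mat (mat_diag n a) (mat_diag n b) (mat_diag n c) (mat_diag n d)"

lemma mat_diag_add: "mat_diag n f + mat_diag n g = mat_diag n (\<lambda>i. f i + (g i :: 'a :: monoid_add))"
  by (rule eq_matI) (auto simp: mat_diag_def)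

lemma diag_blocks_carrier [simp]: "diag_blocks n a b c d \<in> carrier_mat (2 * n) (2 * n)"
  unfolding diag_blocks_def mult_2 by (intro four_block_carrier_mat) auto

lemma diag_blocks_cong:
  assumes "\<And>i. i < n \<Longrightarrow> a i = a' i \<and> b i = b' i \<and> c i = c' i \<and> d i = d' i"
  shows "diag_blocks n a b c d = diag_blocks n a' b' c' d'"
proof -
  have *: "mat_diag n f = mat_diag n g" if "\<And>i. i < n \<Longrightarrow> f i = g i" for f g :: "nat \<Rightarrow> 'a"
    by (rule eq_matI) (auto simp: mat_diag_def that)
  show ?thesis
    unfolding diag_blocks_def using assms by (intro cong_four_block_mat *) auto
qed

lemma diag_blocks_mult:
  fixes a b c d :: "nat \<Rightarrow> 'a :: semiring_1"
  shows "diag_blocks n a b c d * diag_blocks n a' b' c' d' =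
    diag_blocks n (\<lambda>i. a i * a' i + b i * c' i) (\<lambda>i. a i * b' i + b i * d' i)
      (\<lambda>i. c i * a' i + d i * c' i) (\<lambda>i. c i * b' i + d i * d' i)"
  unfolding diag_blocks_def
  by (subst mult_four_block_mat[where ?nr1.0 = n and ?nr2.0 = n and ?n1.0 = n and ?n2.0 = n
        and ?nc1.0 = n and ?nc2.0 = n]) (simp_all add: mat_diag_add)

lemma diag_blocks_one: "diag_blocks n (\<lambda>_. 1) (\<lambda>_. 0) (\<lambda>_. 0) (\<lambda>_. 1) = 1\<^sub>m (2 * n)"
  by (rule eq_matI) (auto simp: diag_blocks_def mat_diag_def)

lemma diag_blocks_transpose: "(diag_blocks n a b c d)\<^sup>T = diag_blocks n a c b d"
  by (rule eq_matI) (auto simp: diag_blocks_def mat_diag_def)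

lemma diag_blocks_cnj:
  "cnj_mat (diag_blocks n a b c d) =
    diag_blocks n (\<lambda>i. cnj (a i)) (\<lambda>i. cnj (b i)) (\<lambda>i. cnj (c i)) (\<lambda>i. cnj (d i))"
  by (rule eq_matI) (auto simp: diag_blocks_def mat_diag_def)

text \<open>The matrix \<open>J\<close>: the image under \<open>complexify\<close> of
  \<open>quat_j\<close> times the identity.\<close>

definition sympl_mat :: "nat \<Rightarrow> complex mat" where
  "sympl_mat n = diag_blocks n (\<lambda>_. 0) (\<lambda>_. 1) (\<lambda>_. - 1) (\<lambda>_. 0)"

lemma sympl_mat_carrier [simp]: "sympl_mat n \<in> carrier_mat (2 * n) (2 * n)"
  by (simp add: sympl_mat_def)

lemma sympl_mat_transpose: "(sympl_mat n)\<^sup>T = - sympl_mat n"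
  by (rule eq_matI) (auto simp: sympl_mat_def diag_blocks_def mat_diag_def)

lemma sympl_mat_cnj: "cnj_mat (sympl_mat n) = sympl_mat n"
  by (simp add: sympl_mat_def diag_blocks_cnj)

lemma hyperbolic_mat_blocks:
  "hyperbolic_mat n \<theta> = diag_blocks n (\<lambda>m. complex_of_real (cosh (\<theta> m))) (\<lambda>m. \<i> * complex_of_real (sinh (\<theta> m)))
    (\<lambda>m. - \<i> * complex_of_real (sinh (\<theta> m))) (\<lambda>m. complex_of_real (cosh (\<theta> m)))"
  unfolding hyperbolic_mat_def Let_def diag_blocks_def
  by (rule cong_four_block_mat; rule eq_matI) (auto simp: mat_diag_def)

lemma hyperbolic_mat_carrier [simp]: "hyperbolic_mat n \<theta> \<in> carrier_mat (2 * n) (2 * n)"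
  by (simp add: hyperbolic_mat_blocks)

text \<open>Each two-by-two piece is \<open>cosh \<theta> + \<i> sinh \<theta> J\<close> with
  \<open>(\<i> J)^2 = 1\<close>, so the addition formulas give the exponential law.\<close>

lemma hyperbolic_mat_mult:
  "hyperbolic_mat n \<theta> * hyperbolic_mat n \<phi> = hyperbolic_mat n (\<lambda>m. \<theta> m + \<phi> m)"
  unfolding hyperbolic_mat_blocks diag_blocks_mult
  by (rule diag_blocks_cong) (auto simp: cosh_add sinh_add algebra_simps)

lemma hyperbolic_mat_zero: "hyperbolic_mat n (\<lambda>_. 0) = 1\<^sub>m (2 * n)"
  by (simp add: hyperbolic_mat_blocks diag_blocks_one)

text \<open>\<open>J\<close> is real and skew: transposition negates \<open>J\<close> and
  conjugation negates \<open>\<i>\<close>, so either one negates the angles and thereby inverts the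
  matrix.\<close>

lemma hyperbolic_mat_transpose: "(hyperbolic_mat n \<theta>)\<^sup>T = hyperbolic_mat n (\<lambda>m. - \<theta> m)"
  by (simp add: hyperbolic_mat_blocks diag_blocks_transpose)

lemma hyperbolic_mat_cnj: "cnj_mat (hyperbolic_mat n \<theta>) = hyperbolic_mat n (\<lambda>m. - \<theta> m)"
  by (simp add: hyperbolic_mat_blocks diag_blocks_cnj)

lemma hyperbolic_mat_inverse:
  "hyperbolic_mat n \<theta> * hyperbolic_mat n (\<lambda>m. - \<theta> m) = 1\<^sub>m (2 * n)"
  "hyperbolic_mat n (\<lambda>m. - \<theta> m) * hyperbolic_mat n \<theta> = 1\<^sub>m (2 * n)"
  by (simp_all add: hyperbolic_mat_mult hyperbolic_mat_zero)

lemma hyperbolic_mat_sympl_mat: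
  "hyperbolic_mat n \<theta> * sympl_mat n = sympl_mat n * hyperbolic_mat n \<theta>"
  by (simp add: hyperbolic_mat_blocks sympl_mat_def diag_blocks_mult)

section \<open>Complexified quaternionic matrices\<close>

lemma complexify_carrier: "V \<in> carrier_mat n m \<Longrightarrow> complexify V \<in> carrier_mat (2 * n) (2 * m)"
  unfolding complexify_def mult_2 by (intro four_block_carrier_mat) auto

lemma complexify_index:
  assumes "V \<in> carrier_mat n n" "i < n" "j < n"
  shows "complexify V $$ (i, j) = Complex (qRe (V $$ (i, j))) (qI (V $$ (i, j)))"
    and "complexify V $$ (i, j + n) = Complex (qJ (V $$ (i, j))) (qK (V $$ (i, j)))"
    and "complexify V $$ (i + n, j) = Complex (- qJ (V $$ (i, j))) (qK (V $$ (i, j)))"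
    and "complexify V $$ (i + n, j + n) = Complex (qRe (V $$ (i, j))) (- qI (V $$ (i, j)))"
  using assms by (auto simp: complexify_def)

lemma complexify_inject:
  assumes "V \<in> carrier_mat n n" "W \<in> carrier_mat n n" "complexify V = complexify W"
  shows "V = W"
proof (rule eq_matI)
  fix i j assume "i < dim_row W" "j < dim_col W"
  with assms have ij: "i < n" "j < n" by auto
  show "V $$ (i, j) = W $$ (i, j)"
    using complexify_index(1,2)[OF assms(1) ij] complexify_index(1,2)[OF assms(2) ij] assms(3)
    by (auto simp: quat_eq_iff)
qed (use assms in auto)

lemma complexify_one: "complexify (1\<^sub>m n) = 1\<^sub>m (2 * n)"
  by (rule eq_matI) (auto simp: complexify_def one_quat_def zero_quat_def complex_eq_iff)

lemma quat_sum_components: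
  "qRe (sum f S) = (\<Sum>x\<in>S. qRe (f x))" "qI (sum f S) = (\<Sum>x\<in>S. qI (f x))"
  "qJ (sum f S) = (\<Sum>x\<in>S. qJ (f x))" "qK (sum f S) = (\<Sum>x\<in>S. qK (f x))"
  by (induction S rule: infinite_finite_induct) (auto simp: zero_quat_def plus_quat_def)

lemma complexify_mult:
  assumes V: "V \<in> carrier_mat n n" and W: "W \<in> carrier_mat n n"
  shows "complexify (V * W) = complexify V * complexify W"
proof -
  have *: "complexify V * complexify W = four_block_mat
      (map_mat (\<lambda>y. Complex (qRe y) (qI y)) V * map_mat (\<lambda>y. Complex (qRe y) (qI y)) W +
       map_mat (\<lambda>y. Complex (qJ y) (qK y)) V * map_mat (\<lambda>y. Complex (- qJ y) (qK y)) W)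
      (map_mat (\<lambda>y. Complex (qRe y) (qI y)) V * map_mat (\<lambda>y. Complex (qJ y) (qK y)) W +
       map_mat (\<lambda>y. Complex (qJ y) (qK y)) V * map_mat (\<lambda>y. Complex (qRe y) (- qI y)) W)
      (map_mat (\<lambda>y. Complex (- qJ y) (qK y)) V * map_mat (\<lambda>y. Complex (qRe y) (qI y)) W +
       map_mat (\<lambda>y. Complex (qRe y) (- qI y)) V * map_mat (\<lambda>y. Complex (- qJ y) (qK y)) W)
      (map_mat (\<lambda>y. Complex (- qJ y) (qK y)) V * map_mat (\<lambda>y. Complex (qJ y) (qK y)) W +
       map_mat (\<lambda>y. Complex (qRe y) (- qI y)) V * map_mat (\<lambda>y. Complex (qRe y) (- qI y)) W)"
    unfolding complexify_def
    by (rule mult_four_block_mat[where ?nr1.0 = n and ?nr2.0 = n and ?n1.0 = n and ?n2.0 = n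
        and ?nc1.0 = n and ?nc2.0 = n]) (use assms in auto)
  show ?thesis
    unfolding *
    by (subst complexify_def, rule cong_four_block_mat; rule eq_matI; use assms in
      \<open>simp add: scalar_prod_def complex_eq_iff quat_sum_components times_quat_def
        sum.distrib sum_subtractf sum_negf algebra_simps\<close>)
qed

text \<open>On a single entry, conjugation followed by \<open>x\<close> to \<open>- j x j\<close>
  changes only the sign of the \<open>j\<close> component, which is also the effect of transposing
  its two-by-two complex matrix.\<close>

lemma complexify_adjoint_j:
  assumes "V \<in> carrier_mat n n"
  shows "complexify (quat_adjoint_j V) = (complexify V)\<^sup>T"
  using assms
  by (intro eq_matI)
    (auto simp: complexify_def quat_adjoint_j_def quat_adjoint_def quat_cnj_def quat_j_def
      times_quat_def uminus_quat_def complex_eq_iff)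

text \<open>Because \<open>complexify\<close> is injective, multiplicative and turns the twisted
  adjoint into the transpose, quaternionic orthogonality is complex orthogonality of the
  image.\<close>

lemma quat_orthogonal_iff:
  "quat_orthogonal n V \<longleftrightarrow>
    V \<in> carrier_mat n n \<and> (complexify V)\<^sup>T * complexify V = 1\<^sub>m (2 * n)"
proof (cases "V \<in> carrier_mat n n")
  case True
  then have *: "quat_adjoint_j V \<in> carrier_mat n n"
    by (simp add: quat_adjoint_j_def quat_adjoint_def)
  have "quat_adjoint_j V * V = 1\<^sub>m n \<longleftrightarrow> complexify (quat_adjoint_j V * V) = complexify (1\<^sub>m n)"
    using True * complexify_inject[of "quat_adjoint_j V * V" n "1\<^sub>m n"] by fastforce
  then show ?thesis
    using True * by (simp add: quat_orthogonal_def complexify_mult complexify_one complexify_adjoint_j)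
qed (simp add: quat_orthogonal_def)

lemma sympl_mat_mult_four_block:
  assumes "a \<in> carrier_mat n m" "b \<in> carrier_mat n m" "c \<in> carrier_mat n m" "d \<in> carrier_mat n m"
  shows "sympl_mat n * four_block_mat a b c d = four_block_mat c d (- a) (- b)"
    and "four_block_mat a b c d * sympl_mat m = four_block_mat (- b) a (- d) c"
proof -
  have [simp]: "mat_diag k (\<lambda>_. 0) = (0\<^sub>m k k :: complex mat)"
    "mat_diag k (\<lambda>_. - 1) = - (1\<^sub>m k :: complex mat)"
    for k :: nat by (rule eq_matI; simp add: mat_diag_def)+
  show "sympl_mat n * four_block_mat a b c d = four_block_mat c d (- a) (- b)"
    unfolding sympl_mat_def diag_blocks_def
    by (subst mult_four_block_mat[where ?nr1.0 = n and ?nr2.0 = n and ?n1.0 = n and ?n2.0 = n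
        and ?nc1.0 = m and ?nc2.0 = m]) (use assms in auto)
  show "four_block_mat a b c d * sympl_mat m = four_block_mat (- b) a (- d) c"
    unfolding sympl_mat_def diag_blocks_def
    by (subst mult_four_block_mat[where ?nr1.0 = n and ?nr2.0 = n and ?n1.0 = m and ?n2.0 = m
        and ?nc1.0 = m and ?nc2.0 = m]) (use assms in auto)
qed

lemma complexify_commute:
  assumes "V \<in> carrier_mat n n"
  shows "cnj_mat (complexify V) * sympl_mat n = sympl_mat n * complexify V"
proof -
  let ?a = "map_mat (\<lambda>y. Complex (qRe y) (qI y)) V" and ?b = "map_mat (\<lambda>y. Complex (qJ y) (qK y)) V"
    and ?c = "map_mat (\<lambda>y. Complex (- qJ y) (qK y)) V" and ?d = "map_mat (\<lambda>y. Complex (qRe y) (- qI y)) V"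
  have "cnj_mat (complexify V) = four_block_mat (cnj_mat ?a) (cnj_mat ?b) (cnj_mat ?c) (cnj_mat ?d)"
    unfolding complexify_def using assms by (intro map_four_block_mat) auto
  then show ?thesis
    using assms unfolding complexify_def
    by (subst sympl_mat_mult_four_block(1)[of _ _ n])
      (auto simp: sympl_mat_mult_four_block(2)[of _ n n] complex_eq_iff intro!: eq_matI)
qed

text \<open>Converse of \<open>complexify_commute\<close>. In blocks the relation says
  \<open>c = - cnj b\<close> and \<open>d = cnj a\<close>, so the upper blocks \<open>a\<close> and
  \<open>b\<close> supply the four components of each quaternion entry.\<close>

lemma complexify_obtain:
  assumes W: "W \<in> carrier_mat (2 * n) (2 * n)"
    and comm: "cnj_mat W * sympl_mat n = sympl_mat n * W"
  obtains V where "V \<in> carrier_mat n n" "W = complexify V"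
proof -
  obtain a b c d where split: "split_block W n n = (a, b, c, d)"
    by (cases "split_block W n n") auto
  from W have "dim_row W = n + n" "dim_col W = n + n" by auto
  from split_block[OF split this]
  have car: "a \<in> carrier_mat n n" "b \<in> carrier_mat n n" "c \<in> carrier_mat n n" "d \<in> carrier_mat n n"
    and Weq: "W = four_block_mat a b c d" by auto
  have "cnj_mat W = four_block_mat (cnj_mat a) (cnj_mat b) (cnj_mat c) (cnj_mat d)"
    unfolding Weq using car by (intro map_four_block_mat) auto
  with comm car
  have eq: "four_block_mat (- cnj_mat b) (cnj_mat a) (- cnj_mat d) (cnj_mat c) =
      four_block_mat c d (- a) (- b)"
    unfolding Weq by (simp add: sympl_mat_mult_four_block[of _ n n])
  have entries: "c $$ (i, j) = - cnj (b $$ (i, j))" "d $$ (i, j) = cnj (a $$ (i, j))"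
    if "i < n" "j < n" for i j
    using arg_cong[OF eq, of "\<lambda>X. X $$ (i, j)"] arg_cong[OF eq, of "\<lambda>X. X $$ (i, j + n)"] that car
    by auto
  let ?V = "mat n n (\<lambda>(i, j). Quat (Re (a $$ (i, j))) (Im (a $$ (i, j)))
     (Re (b $$ (i, j))) (Im (b $$ (i, j))))"
  have "W = complexify ?V"
    unfolding Weq complexify_def
    by (rule cong_four_block_mat; rule eq_matI) (use car entries in \<open>auto simp: complex_eq_iff\<close>)
  then show thesis
    using that[of ?V] by simp
qed

section \<open>Hermitian matrices\<close>

abbreviation ctranspose :: "complex mat \<Rightarrow> complex mat" where
  "ctranspose A \<equiv> cnj_mat (A\<^sup>T)"

lemma cscalar_prod_self:
  fixes v :: "complex vec"
  assumes "v \<in> carrier_vec n" "v \<noteq> 0\<^sub>v n"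
  obtains s :: real where "s > 0" "v \<bullet>c v = complex_of_real (s\<^sup>2)"
proof
  have eq: "v \<bullet>c v = complex_of_real (\<Sum>i<n. (cmod (v $ i))\<^sup>2)"
    using assms(1)
    by (simp add: scalar_prod_def conjugate_complex_def complex_mult_cnj cmod_power2 lessThan_atLeast0)
  moreover have "v \<bullet>c v \<noteq> 0"
    using assms by simp
  ultimately have "(\<Sum>i<n. (cmod (v $ i))\<^sup>2) > 0"
    by (metis (mono_tags, lifting) less_eq_real_def of_real_0 sum_nonneg zero_le_power2)
  then show "sqrt (\<Sum>i<n. (cmod (v $ i))\<^sup>2) > 0"
    "v \<bullet>c v = complex_of_real ((sqrt (\<Sum>i<n. (cmod (v $ i))\<^sup>2))\<^sup>2)"
    using eq by auto
qed

text \<open>Complete \<open>v\<close> to a basis, orthogonalize by Gram-Schmidt, which keeps the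
  head \<open>v\<close>, and divide every vector by its length; \<open>c\<close> is the reciprocal
  length of \<open>v\<close>.\<close>

lemma unitary_completion:
  fixes v :: "complex vec"
  assumes v: "v \<in> carrier_vec n" and v0: "v \<noteq> 0\<^sub>v n"
  obtains W c where "W \<in> carrier_mat n n" "ctranspose W * W = 1\<^sub>m n" "col W 0 = c \<cdot>\<^sub>v v"
proof -
  interpret cof_vec_space n "TYPE(complex)" .
  define b where "b = basis_completion v"
  define ws where "ws = gram_schmidt n b"
  from basis_completion[OF v v0, folded b_def]
  have b: "distinct b" "\<not> lin_dep (set b)" "set b \<subseteq> carrier_vec n" "hd b = v" "length b = n"
    by auto
  have n: "n \<noteq> 0" using v v0 by auto
  with b obtain vs where bv: "b = v # vs" by (cases b) auto
  from gram_schmidt_result[OF b(3,1,2) refl, folded ws_def] b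
  have ws: "set ws \<subseteq> carrier_vec n" "corthogonal ws" "length ws = n" by auto
  from gram_schmidt_hd[OF v, of vs, folded bv] have "hd ws = v" unfolding ws_def .
  with ws n have ws0: "ws ! 0 = v" by (cases ws) auto
  have car: "ws ! j \<in> carrier_vec n" if "j < n" for j using that ws by auto
  have "ws ! j \<noteq> 0\<^sub>v n" if "j < n" for j
  proof
    assume "ws ! j = 0\<^sub>v n"
    then have "ws ! j \<bullet>c ws ! j = 0" by simp
    then show False using corthogonalD[OF ws(2), of j j] ws(3) that by simp
  qed
  then have "\<exists>s :: real. s > 0 \<and> ws ! j \<bullet>c ws ! j = complex_of_real (s\<^sup>2)" if "j < n" for j
    using cscalar_prod_self[OF car[OF that]] that by metis
  then obtain s :: "nat \<Rightarrow> real" where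
    s: "\<And>j. j < n \<Longrightarrow> s j > 0 \<and> ws ! j \<bullet>c ws ! j = complex_of_real ((s j)\<^sup>2)"
    by metis
  define W where "W = mat n n (\<lambda>(i, j). ws ! j $ i / complex_of_real (s j))"
  have W: "W \<in> carrier_mat n n" by (simp add: W_def)
  have "ctranspose W * W = 1\<^sub>m n"
  proof (rule eq_matI)
    fix i j assume "i < dim_row (1\<^sub>m n :: complex mat)" "j < dim_col (1\<^sub>m n :: complex mat)"
    then have ij: "i < n" "j < n" by auto
    have "(ctranspose W * W) $$ (i, j) =
        (ws ! j \<bullet>c ws ! i) / (complex_of_real (s i) * complex_of_real (s j))"
      using ij car[of i] car[of j]
      by (simp add: W_def scalar_prod_def conjugate_complex_def sum_divide_distrib mult_ac)
    also have "\<dots> = (1\<^sub>m n) $$ (i, j)"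
      using ij s[of i] s[of j] corthogonalD[OF ws(2), of j i] ws(3) by (auto simp: power2_eq_square)
    finally show "(ctranspose W * W) $$ (i, j) = (1\<^sub>m n) $$ (i, j)" .
  qed (auto simp: W_def)
  moreover have "col W 0 = complex_of_real (1 / s 0) \<cdot>\<^sub>v v"
    using n v by (intro eq_vecI) (auto simp: W_def ws0)
  ultimately show thesis using W that by blast
qed

text \<open>Induction on the dimension. A unitary \<open>W\<close> whose first column is an
  eigenvector makes \<open>ctranspose W * K * W\<close> block diagonal, with the eigenvalue in the
  corner and a smaller Hermitian block.\<close>

lemma hermitian_spectral:
  assumes "K \<in> carrier_mat n n" "ctranspose K = K"
  obtains Q \<mu> where "Q \<in> carrier_mat n n" "ctranspose Q * Q = 1\<^sub>m n"
    "K * Q = Q * mat_diag n (\<lambda>i. complex_of_real (\<mu> i))"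
proof -
  have "\<exists>Q \<mu>. Q \<in> carrier_mat n n \<and> ctranspose Q * Q = 1\<^sub>m n \<and>
      K * Q = Q * mat_diag n (\<lambda>i. complex_of_real (\<mu> i))"
    using assms
  proof (induction n arbitrary: K)
    case 0
    show ?case
      by (intro exI[of _ "1\<^sub>m 0"] exI[of _ "\<lambda>_. 0"] conjI; (rule eq_matI)?) (use 0 in \<open>auto simp: mat_diag_def\<close>)
  next
    case (Suc n)
    let ?N = "Suc n"
    note K = Suc.prems(1) and herm = Suc.prems(2)
    obtain as where as: "char_poly K = (\<Prod>a\<leftarrow>as. [:- a, 1:])" "length as = ?N"
      using char_poly_factorized[OF K] by auto
    then obtain e as' where "as = e # as'" by (cases as) auto
    with as(1) have "eigenvalue K e"
      by (simp add: eigenvalue_root_char_poly[OF K])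
    then obtain v where v: "v \<in> carrier_vec ?N" "v \<noteq> 0\<^sub>v ?N" and ev: "K *\<^sub>v v = e \<cdot>\<^sub>v v"
      using K unfolding eigenvalue_def eigenvector_def by auto
    obtain W c where W: "W \<in> carrier_mat ?N ?N" and WW: "ctranspose W * W = 1\<^sub>m ?N"
      and W0: "col W 0 = c \<cdot>\<^sub>v v"
      using unitary_completion[OF v] by metis
    have Wt: "ctranspose W \<in> carrier_mat ?N ?N" using W by simp
    have WW': "W * ctranspose W = 1\<^sub>m ?N"
      using mat_mult_left_right_inverse[OF Wt W WW] .
    define B where "B = ctranspose W * (K * W)"
    have B: "B \<in> carrier_mat ?N ?N" using W K by (simp add: B_def)
    have KW: "K * W = W * B"
      unfolding B_def using mult_cancel_left_inverse[OF WW' W Wt] K W by simp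
    have Bherm: "ctranspose B = B"
    proof -
      have "ctranspose B = ctranspose (K * W) * W"
        using W K by (simp add: B_def transpose_mult[of _ ?N ?N _ ?N] cnj_mat_mult[of _ ?N ?N _ ?N]
            map_mat_transpose[symmetric])
      also have "\<dots> = ctranspose W * K * W"
        using W K herm
        by (simp add: transpose_mult[of _ ?N ?N _ ?N] cnj_mat_mult[of _ ?N ?N _ ?N])
      also have "\<dots> = B" using W K by (simp add: B_def assoc_mult_mat[of _ ?N ?N _ ?N _ ?N])
      finally show ?thesis .
    qed
    \<comment> \<open>\<open>W\<close> maps the first unit vector to an eigenvector of
      \<open>K\<close>, so the first column of \<open>B\<close> is \<open>e\<close> times the first
      unit vector.\<close>
    have col0: "B $$ (i, 0) = (if i = 0 then e else 0)" if "i < ?N" for i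
    proof -
      have "col (K * W) 0 = K *\<^sub>v (c \<cdot>\<^sub>v v)"
        by (simp add: col_mult2[OF K W] W0)
      also have "\<dots> = e \<cdot>\<^sub>v col W 0"
        by (simp only: mult_mat_vec[OF K v(1)] ev W0 smult_smult_assoc mult.commute)
      finally have "B $$ (i, 0) = row (ctranspose W) i \<bullet> (e \<cdot>\<^sub>v col W 0)"
        using that W K by (simp add: B_def)
      also have "\<dots> = e * (ctranspose W * W) $$ (i, 0)"
        using that W by simp
      also have "\<dots> = (if i = 0 then e else 0)"
        using that by (simp add: WW)
      finally show ?thesis .
    qed
    have sym: "B $$ (i, j) = cnj (B $$ (j, i))" if "i < ?N" "j < ?N" for i j
      using arg_cong[OF Bherm, of "\<lambda>X. X $$ (i, j)"] that B by simp
    have "e \<in> \<real>"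
      using sym[of 0 0] col0[of 0] by (simp add: Reals_cnj_iff)
    then obtain r where r: "e = complex_of_real r" by (rule Reals_cases)
    define K' where "K' = mat n n (\<lambda>(i, j). B $$ (Suc i, Suc j))"
    have K': "K' \<in> carrier_mat n n" by (simp add: K'_def)
    have "ctranspose K' = K'"
      by (rule eq_matI) (auto simp: K'_def sym[symmetric])
    from Suc.IH[OF K' this] obtain Q \<mu> where
      Q: "Q \<in> carrier_mat n n" "ctranspose Q * Q = 1\<^sub>m n"
        "K' * Q = Q * mat_diag n (\<lambda>i. complex_of_real (\<mu> i))"
      by auto
    let ?E = "mat 1 1 (\<lambda>_. e) :: complex mat" and ?Z = "0\<^sub>m 1 n :: complex mat" and ?Z' = "0\<^sub>m n 1 :: complex mat"
    let ?D = "mat_diag n (\<lambda>i. complex_of_real (\<mu> i))"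
    let ?\<mu> = "case_nat r \<mu>"
    define P where "P = four_block_mat (1\<^sub>m 1) ?Z ?Z' Q"
    have P: "P \<in> carrier_mat ?N ?N"
      using four_block_carrier_mat[of "1\<^sub>m 1 :: complex mat" 1 1 Q n n] Q by (simp add: P_def)
    \<comment> \<open>The first column is known from \<open>col0\<close>, and Hermitian symmetry
      carries its zeros over to the first row.\<close>
    have Beq: "B = four_block_mat ?E ?Z ?Z' K'"
    proof (rule eq_matI)
      fix i j assume "i < dim_row (four_block_mat ?E ?Z ?Z' K')" "j < dim_col (four_block_mat ?E ?Z ?Z' K')"
      then have "i < ?N" "j < ?N" by (auto simp: K'_def)
      then show "B $$ (i, j) = four_block_mat ?E ?Z ?Z' K' $$ (i, j)"
        using col0[of i] col0[of j] sym[of i j]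
        by (cases i; cases j) (auto simp: K'_def)
    qed (use B in \<open>auto simp: K'_def\<close>)
    have Deq: "mat_diag ?N (\<lambda>i. complex_of_real (?\<mu> i)) = four_block_mat ?E ?Z ?Z' ?D"
      by (rule eq_matI) (auto simp: mat_diag_def r split: nat.split)
    have BP1: "B * P = four_block_mat ?E ?Z ?Z' (K' * Q)"
      unfolding Beq P_def
      by (subst mult_four_block_mat[where ?nr1.0 = 1 and ?nr2.0 = n and ?n1.0 = 1 and ?n2.0 = n
        and ?nc1.0 = 1 and ?nc2.0 = n]) (use Q K' in auto)
    have zD: "?Z * ?D = ?Z"
      by (rule left_mult_zero_mat[OF mat_diag_dim])
    have "P * mat_diag ?N (\<lambda>i. complex_of_real (?\<mu> i)) = four_block_mat ?E ?Z ?Z' (Q * ?D)"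
      unfolding Deq P_def
      by (subst mult_four_block_mat[where ?nr1.0 = 1 and ?nr2.0 = n and ?n1.0 = 1 and ?n2.0 = n
        and ?nc1.0 = 1 and ?nc2.0 = n])
        (use Q(1) K' zD in simp_all)
    with BP1 Q(3) have BP: "B * P = P * mat_diag ?N (\<lambda>i. complex_of_real (?\<mu> i))"
      by simp
    have Pt: "ctranspose P = four_block_mat (1\<^sub>m 1) ?Z ?Z' (ctranspose Q)"
      using Q by (intro eq_matI) (auto simp: P_def)
    have z: "?Z * Q = ?Z" "ctranspose Q * ?Z' = ?Z'"
      using left_mult_zero_mat[OF Q(1), of 1] right_mult_zero_mat[of "ctranspose Q" n n 1] Q(1)
      by simp_all
    have "ctranspose P * P =
        four_block_mat (1\<^sub>m 1) ?Z ?Z' (ctranspose Q) * four_block_mat (1\<^sub>m 1) ?Z ?Z' Q"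
      unfolding Pt by (simp only: P_def)
    also have "\<dots> = 1\<^sub>m (1 + n)"
      by (subst mult_four_block_mat[where ?nr1.0 = 1 and ?nr2.0 = n and ?n1.0 = 1 and ?n2.0 = n
        and ?nc1.0 = 1 and ?nc2.0 = n])
        (use Q(1,2) z in simp_all)
    finally have PP: "ctranspose P * P = 1\<^sub>m ?N" by simp
    have Pc: "ctranspose P \<in> carrier_mat ?N ?N" using P by simp
    have D: "mat_diag ?N (\<lambda>i. complex_of_real (?\<mu> i)) \<in> carrier_mat ?N ?N" by simp
    have WP: "W * P \<in> carrier_mat ?N ?N" using W P by simp
    have "ctranspose (W * P) = ctranspose P * ctranspose W"
      using cnj_mat_mult[of "P\<^sup>T" ?N ?N "W\<^sup>T" ?N] W P by (simp only: transpose_mult[OF W P] transpose_carrier_mat)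
    then have "ctranspose (W * P) * (W * P) = ctranspose P * (ctranspose W * (W * P))"
      by (simp only: assoc_mult_mat[OF Pc Wt WP])
    also have "\<dots> = 1\<^sub>m ?N"
      by (simp only: mult_cancel_left_inverse[OF WW Wt W P] PP)
    finally have 1: "ctranspose (W * P) * (W * P) = 1\<^sub>m ?N" .
    have "K * (W * P) = W * (B * P)"
      by (simp only: assoc_mult_mat[OF K W P, symmetric] KW assoc_mult_mat[OF W B P])
    also have "\<dots> = W * P * mat_diag ?N (\<lambda>i. complex_of_real (?\<mu> i))"
      by (simp only: BP assoc_mult_mat[OF W P D])
    finally show ?case
      using 1 WP by blast
  qed
  then show thesis using that by blast
qed

section \<open>The canonical form\<close>

text \<open>The angles are \<open>- 2 \<theta>\<close> because conjugation and transposition each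
  contribute one inverse hyperbolic factor to \<open>cnj A * J * A^T\<close>, and \<open>J\<close>
  commutes with these factors.\<close>

definition canonical_mat :: "nat \<Rightarrow> (nat \<Rightarrow> real) \<Rightarrow> complex mat" where
  "canonical_mat n \<theta> = sympl_mat n * hyperbolic_mat n (\<lambda>m. - (2 * \<theta> m))"

text \<open>Indices below \<open>n\<close> carry the values on the positive imaginary axis; index
  \<open>i + n\<close> carries the partner \<open>- \<i> / \<mu>\<close> of the value
  \<open>\<i> \<mu>\<close> at index \<open>i\<close>.\<close>

definition canonical_eigenvalue :: "nat \<Rightarrow> (nat \<Rightarrow> real) \<Rightarrow> nat \<Rightarrow> complex" where
  "canonical_eigenvalue n \<theta> i =
    (if i < n then \<i> * complex_of_real (exp (2 * \<theta> i)) else - \<i> * complex_of_real (exp (- 2 * \<theta> (i - n))))"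

text \<open>Turns a matrix \<open>[X, cnj X]\<close> into the real matrix \<open>\<surd>2 [Re X, Im X]\<close>.\<close>

definition cayley_mat :: "nat \<Rightarrow> complex mat" where
  "cayley_mat n = (let s = complex_of_real (1 / sqrt 2) in
    diag_blocks n (\<lambda>_. s) (\<lambda>_. - \<i> * s) (\<lambda>_. s) (\<lambda>_. \<i> * s))"

lemma canonical_mat_carrier [simp]: "canonical_mat n \<theta> \<in> carrier_mat (2 * n) (2 * n)"
  unfolding canonical_mat_def by (rule mult_carrier_mat[of _ _ "2 * n"]) auto

lemma cayley_mat_carrier [simp]: "cayley_mat n \<in> carrier_mat (2 * n) (2 * n)"
  by (simp add: cayley_mat_def Let_def)

lemma inverse_sqrt2_square:
  "complex_of_real (1 / sqrt 2) * complex_of_real (1 / sqrt 2) = 1 / 2"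
  by (simp flip: of_real_mult)

lemma cayley_mat_unitary: "ctranspose (cayley_mat n) * cayley_mat n = 1\<^sub>m (2 * n)"
proof -
  have "ctranspose (cayley_mat n) * cayley_mat n = diag_blocks n (\<lambda>_. 1) (\<lambda>_. 0) (\<lambda>_. 0) (\<lambda>_. 1)"
    using inverse_sqrt2_square
    unfolding cayley_mat_def Let_def diag_blocks_transpose diag_blocks_cnj diag_blocks_mult
    by (intro diag_blocks_cong) (simp add: algebra_simps)
  then show ?thesis by (simp add: diag_blocks_one)
qed

text \<open>The rows of \<open>cayley_mat\<close> are left eigenvectors of \<open>J\<close> for
  \<open>\<i>\<close> and \<open>- \<i>\<close>, whatever the angles are. Substituting these values
  for \<open>J\<close> in \<open>J exp (- 2 \<i> \<theta> J)\<close> gives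
  \<open>\<i> exp (2 \<theta>)\<close> and \<open>- \<i> exp (- 2 \<theta>)\<close>.\<close>

lemma cayley_mat_canonical_mat:
  "cayley_mat n * canonical_mat n \<theta> = mat_diag (2 * n) (canonical_eigenvalue n \<theta>) * cayley_mat n"
proof -
  have *: "mat_diag (2 * n) (canonical_eigenvalue n \<theta>) =
      diag_blocks n (\<lambda>m. \<i> * complex_of_real (exp (2 * \<theta> m))) (\<lambda>_. 0) (\<lambda>_. 0)
        (\<lambda>m. - \<i> * complex_of_real (exp (- 2 * \<theta> m)))"
    by (rule eq_matI) (auto simp: mat_diag_def diag_blocks_def canonical_eigenvalue_def)
  have exp: "exp (2 * \<theta> m) = cosh (2 * \<theta> m) + sinh (2 * \<theta> m)"
    "exp (- 2 * \<theta> m) = cosh (2 * \<theta> m) - sinh (2 * \<theta> m)" for m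
    by (simp_all add: cosh_plus_sinh cosh_minus_sinh)
  show ?thesis
    unfolding * canonical_mat_def sympl_mat_def hyperbolic_mat_blocks cayley_mat_def Let_def diag_blocks_mult
    by (rule diag_blocks_cong) (simp only: exp, simp add: algebra_simps)
qed

section \<open>Characteristic polynomials and the uniqueness of the angles\<close>

lemma proots_linear_factors:
  "proots (\<Prod>a\<leftarrow>as. [:- a, 1:]) = mset (as :: 'a :: idom list)"
proof (induction as)
  case (Cons a as)
  have "(\<Prod>a\<leftarrow>as. [:- a, 1:]) \<noteq> 0" by (auto simp: prod_list_zero_iff)
  then have "proots ([:- a, 1:] * (\<Prod>a\<leftarrow>as. [:- a, 1:])) = {#a#} + mset as"
    using Cons by (subst proots_mult) auto
  then show ?case by simp
qed simp

text \<open>The columns of \<open>Q\<close> form a basis of eigenvectors, so \<open>M\<close> is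
  similar to the diagonal matrix of the \<open>f i\<close>. The multiset of roots records the
  multiplicities, so two diagonalizations of the same matrix can be compared.\<close>

lemma proots_char_poly_diagonalized:
  fixes M :: "'a :: field mat"
  assumes M: "M \<in> carrier_mat k k" and Q: "Q \<in> carrier_mat k k" and P: "P \<in> carrier_mat k k"
    and PQ: "P * Q = 1\<^sub>m k" and MQ: "M * Q = Q * mat_diag k f"
  shows "proots (char_poly M) = image_mset f (mset_set {..<k})"
proof -
  have QP: "Q * P = 1\<^sub>m k"
    using mat_mult_left_right_inverse[OF P Q PQ] .
  have "M = (M * Q) * P"
    using M Q P QP by (simp add: assoc_mult_mat[of _ k k _ k _ k])
  then have "similar_mat M (mat_diag k f)"
    unfolding similar_mat_def using M Q P PQ QP MQ
    by (intro exI[of _ Q] exI[of _ P] similar_mat_witI[of _ _ k]) auto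
  then have "char_poly M = char_poly (mat_diag k f)" by (rule char_poly_similar)
  also have "\<dots> = (\<Prod>a\<leftarrow>diag_mat (mat_diag k f). [:- a, 1:])"
    by (rule char_poly_upper_triangular[of _ k]) (auto simp: mat_diag_def)
  also have "diag_mat (mat_diag k f) = map f [0..<k]"
    by (auto simp: diag_mat_def mat_diag_def)
  finally have "proots (char_poly M) = mset (map f [0..<k])"
    by (simp only: proots_linear_factors)
  also have "\<dots> = image_mset f (mset_set {..<k})"
    by (simp add: atLeast0LessThan)
  finally show ?thesis .
qed

text \<open>The matrix \<open>U * ctranspose (cayley_mat n)\<close>, with inverse
  \<open>cayley_mat n * U^T\<close>, diagonalizes \<open>M\<close>. The resulting spectrum mentions
  the angles but not \<open>U\<close>.\<close>

lemma proots_char_poly_canonical: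
  assumes M: "M \<in> carrier_mat (2 * n) (2 * n)" and U: "U \<in> carrier_mat (2 * n) (2 * n)"
    and UU: "U\<^sup>T * U = 1\<^sub>m (2 * n)" and MU: "M = U * canonical_mat n \<theta> * U\<^sup>T"
  shows "proots (char_poly M) = image_mset (canonical_eigenvalue n \<theta>) (mset_set {..<2 * n})"
proof -
  let ?N = "2 * n" and ?C = "cayley_mat n" and ?D = "mat_diag (2 * n) (canonical_eigenvalue n \<theta>)"
  have Cs: "ctranspose ?C \<in> carrier_mat ?N ?N" by simp
  have CC': "?C * ctranspose ?C = 1\<^sub>m ?N"
    using mat_mult_left_right_inverse[OF Cs _ cayley_mat_unitary] by simp
  have Ut: "U\<^sup>T \<in> carrier_mat ?N ?N" using U by simp
  have "canonical_mat n \<theta> * ctranspose ?C = ctranspose ?C * (?C * (canonical_mat n \<theta> * ctranspose ?C))"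
    using mult_cancel_left_inverse[OF cayley_mat_unitary Cs] by simp
  also have "\<dots> = ctranspose ?C * ?D"
    using CC' right_mult_one_mat[of ?D ?N ?N] by (simp add: cayley_mat_canonical_mat assoc_mult_mat[of ?D ?N ?N ?C ?N "ctranspose ?C" ?N]
      flip: assoc_mult_mat[of ?C ?N ?N "canonical_mat n \<theta>" ?N "ctranspose ?C" ?N])
  finally have can: "canonical_mat n \<theta> * ctranspose ?C = ctranspose ?C * ?D" .
  have "M * (U * ctranspose ?C) = U * (canonical_mat n \<theta> * (U\<^sup>T * (U * ctranspose ?C)))"
    using U by (simp add: MU assoc_mult_mat[of _ ?N ?N _ ?N _ ?N])
  also have "\<dots> = U * (ctranspose ?C * ?D)"
    using mult_cancel_left_inverse[OF UU Ut U Cs] can by simp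
  also have "\<dots> = U * ctranspose ?C * ?D"
    using U by (simp add: assoc_mult_mat[of _ ?N ?N _ ?N _ ?N])
  finally have MU': "M * (U * ctranspose ?C) = U * ctranspose ?C * ?D" .
  have "?C * U\<^sup>T * (U * ctranspose ?C) = ?C * (U\<^sup>T * (U * ctranspose ?C))"
    using U by (simp add: assoc_mult_mat[of _ ?N ?N _ ?N _ ?N])
  also have "\<dots> = 1\<^sub>m ?N"
    using mult_cancel_left_inverse[OF UU Ut U Cs] CC' by simp
  finally have inv: "?C * U\<^sup>T * (U * ctranspose ?C) = 1\<^sub>m ?N" .
  show ?thesis
    by (rule proots_char_poly_diagonalized[OF M _ _ inv MU'])
      (use U in \<open>auto intro!: mult_carrier_mat[of _ ?N ?N]\<close>)
qed

text \<open>Keeping only the values with positive imaginary part leaves the multiset of the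
  \<open>\<i> exp (2 \<theta> m)\<close> with \<open>m < n\<close>. Equality of these multisets
  gives a permutation of the indices, and injectivity of \<open>exp\<close> gives the
  angles.\<close>

lemma canonical_mat_angles_unique:
  assumes "image_mset (canonical_eigenvalue n \<theta>') (mset_set {..<2 * n}) =
    image_mset (canonical_eigenvalue n \<theta>) (mset_set {..<2 * n})"
  obtains p where "p permutes {..<n}" "\<forall>m<n. \<theta>' m = \<theta> (p m)"
proof -
  have pos: "filter_mset (\<lambda>z. Im z > 0) (image_mset (canonical_eigenvalue n \<phi>) (mset_set {..<2 * n})) =
      image_mset (canonical_eigenvalue n \<phi>) (mset_set {..<n})" for \<phi>
  proof -
    have "{i \<in> {..<2 * n}. 0 < Im (canonical_eigenvalue n \<phi> i)} = {..<n}"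
      by (auto simp: canonical_eigenvalue_def split: if_splits)
    then show ?thesis
      by (simp add: filter_mset_image_mset filter_mset_mset_set)
  qed
  have "image_mset (canonical_eigenvalue n \<theta>') (mset_set {..<n}) =
      image_mset (canonical_eigenvalue n \<theta>) (mset_set {..<n})"
    using arg_cong[OF assms, of "filter_mset (\<lambda>z. Im z > 0)"] by (simp only: pos)
  from image_mset_eq_implies_permutes[OF _ this] obtain p where p: "p permutes {..<n}"
    and eq: "\<forall>m\<in>{..<n}. canonical_eigenvalue n \<theta>' m = canonical_eigenvalue n \<theta> (p m)"
    by auto
  have "\<theta>' m = \<theta> (p m)" if "m < n" for m
    using bspec[OF eq, of m] that permutes_in_image[OF p, of m]
    by (simp add: canonical_eigenvalue_def del: of_real_exp)
  with p that show thesis by blast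
qed

section \<open>Factorizations and canonical forms\<close>

text \<open>Write \<open>G\<close> for the inverse of the hyperbolic factor. Then
  \<open>cnj A = U G cnj V\<close> and \<open>A^T = V^T G U^T\<close>, and \<open>V\<close>
  disappears because \<open>cnj V J V^T = J V V^T = J\<close>.\<close>

lemma factorization_imp_canonical:
  assumes "orthogonal_factorization n A U \<theta> V"
  shows "cnj_mat A * sympl_mat n * A\<^sup>T =
    map_mat complex_of_real U * canonical_mat n \<theta> * (map_mat complex_of_real U)\<^sup>T"
proof -
  let ?N = "2 * n" and ?U = "map_mat complex_of_real U" and ?V = "complexify V" and ?J = "sympl_mat n"
  let ?H = "hyperbolic_mat n \<theta>" and ?G = "hyperbolic_mat n (\<lambda>m. - \<theta> m)"
  note asc = assoc_mult_mat[of _ ?N ?N _ ?N _ ?N]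
  from assms have U: "?U \<in> carrier_mat ?N ?N" and V: "V \<in> carrier_mat n n"
    and VV: "?V\<^sup>T * ?V = 1\<^sub>m ?N" and A: "A = ?U * ?H * ?V"
    by (auto simp: orthogonal_factorization_def orthonormal_mat_def quat_orthogonal_iff)
  from complexify_carrier[OF V] have Vc: "?V \<in> carrier_mat ?N ?N" and Vt: "?V\<^sup>T \<in> carrier_mat ?N ?N"
    by auto
  have VV': "?V * ?V\<^sup>T = 1\<^sub>m ?N"
    using mat_mult_left_right_inverse[OF Vt Vc VV] .
  have Ut: "?U\<^sup>T \<in> carrier_mat ?N ?N" using U by simp
  note car = U Ut Vc Vt
  have comm: "cnj_mat ?V * (?J * X) = ?J * (?V * X)" if "X \<in> carrier_mat ?N ?N" for X
    using complexify_commute[OF V] car that by (simp flip: asc)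
  have GJ: "?G * (?J * X) = ?J * (?G * X)" if "X \<in> carrier_mat ?N ?N" for X
    using hyperbolic_mat_sympl_mat[of n "\<lambda>m. - \<theta> m"] car that by (simp flip: asc)
  have dbl: "(\<lambda>m. - \<theta> m + - \<theta> m) = (\<lambda>m. - (2 * \<theta> m))" by auto
  have GG: "?G * (?G * X) = hyperbolic_mat n (\<lambda>m. - (2 * \<theta> m)) * X"
    if "X \<in> carrier_mat ?N ?N" for X
    using that dbl by (simp add: hyperbolic_mat_mult flip: asc)
  have "cnj_mat A = ?U * (?G * cnj_mat ?V)"
    using car by (simp add: A cnj_mat_mult[of _ ?N ?N _ ?N] hyperbolic_mat_cnj asc)
  moreover have "A\<^sup>T = ?V\<^sup>T * (?G * ?U\<^sup>T)"
    using car by (simp add: A transpose_mult[of _ ?N ?N _ ?N] hyperbolic_mat_transpose asc)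
  ultimately have "cnj_mat A * ?J * A\<^sup>T = ?U * (?G * (cnj_mat ?V * (?J * (?V\<^sup>T * (?G * ?U\<^sup>T)))))"
    using car by (simp add: asc)
  also have "\<dots> = ?U * (?G * (?J * (?G * ?U\<^sup>T)))"
    using car by (simp add: comm mult_cancel_left_inverse[OF VV' Vc Vt])
  also have "\<dots> = ?U * canonical_mat n \<theta> * ?U\<^sup>T"
    using car by (simp add: GJ GG canonical_mat_def asc)
  finally show ?thesis .
qed

text \<open>The factor \<open>complexify V\<close> has to be \<open>W = G U^T A\<close> with
  \<open>G\<close> the inverse hyperbolic matrix. This \<open>W\<close> is orthogonal, and the
  canonical form yields \<open>cnj W J = J W\<close>, so \<open>W\<close> comes from a quaternionic
  matrix.\<close>

lemma canonical_imp_factorization: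
  assumes A: "orthonormal_mat (2 * n) A" and U: "orthonormal_mat (2 * n) U"
    and can: "cnj_mat A * sympl_mat n * A\<^sup>T =
      map_mat complex_of_real U * canonical_mat n \<theta> * (map_mat complex_of_real U)\<^sup>T"
  obtains V where "orthogonal_factorization n A U \<theta> V"
proof -
  let ?N = "2 * n" and ?U = "map_mat complex_of_real U" and ?J = "sympl_mat n"
  let ?H = "hyperbolic_mat n \<theta>" and ?G = "hyperbolic_mat n (\<lambda>m. - \<theta> m)"
  let ?G2 = "hyperbolic_mat n (\<lambda>m. - (2 * \<theta> m))"
  note asc = assoc_mult_mat[of _ ?N ?N _ ?N _ ?N]
  note HG = hyperbolic_mat_inverse[of n \<theta>]
  from A have Ac: "A \<in> carrier_mat ?N ?N" "A\<^sup>T \<in> carrier_mat ?N ?N" and AA: "A\<^sup>T * A = 1\<^sub>m ?N"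
    by (auto simp: orthonormal_mat_def)
  from U have Uc: "?U \<in> carrier_mat ?N ?N" and Ut: "?U\<^sup>T \<in> carrier_mat ?N ?N"
    and "U \<in> carrier_mat ?N ?N" "U\<^sup>T * U = 1\<^sub>m ?N"
    by (auto simp: orthonormal_mat_def)
  then have UU: "?U\<^sup>T * ?U = 1\<^sub>m ?N"
    using of_real_mat_mult[of "U\<^sup>T" ?N ?N U ?N]
    by (simp add: map_mat_transpose of_real_hom.mat_hom_one)
  have UU': "?U * ?U\<^sup>T = 1\<^sub>m ?N"
    using mat_mult_left_right_inverse[OF Ut Uc UU] .
  note car = Ac Uc Ut
  define W where "W = ?G * (?U\<^sup>T * A)"
  have W: "W \<in> carrier_mat ?N ?N"
    unfolding W_def by (intro mult_carrier_mat[of _ ?N ?N] car) auto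
  have "W\<^sup>T = A\<^sup>T * (?U * ?H)"
    using car by (simp add: W_def transpose_mult[of _ ?N ?N _ ?N] hyperbolic_mat_transpose asc)
  then have WW: "W\<^sup>T * W = 1\<^sub>m ?N"
    using car AA by (simp add: W_def asc mult_cancel_left_inverse[OF HG(1)]
      mult_cancel_left_inverse[OF UU' Uc Ut])
  \<comment> \<open>Multiplying by \<open>A\<close> on the right removes \<open>A^T\<close> and
    isolates \<open>cnj A * J\<close>.\<close>
  have "cnj_mat A * ?J = cnj_mat A * ?J * A\<^sup>T * A"
    using car AA by (simp add: asc right_mult_one_mat[of _ ?N ?N])
  also have "\<dots> = ?U * (?J * (?G2 * (?U\<^sup>T * A)))"
    unfolding can using car by (simp add: asc canonical_mat_def)
  finally have AJ: "cnj_mat A * ?J = ?U * (?J * (?G2 * (?U\<^sup>T * A)))" .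
  have HJ: "?H * (?J * X) = ?J * (?H * X)" if "X \<in> carrier_mat ?N ?N" for X
    using hyperbolic_mat_sympl_mat[of n \<theta>] car that by (simp flip: asc)
  have HG2: "?H * (?G2 * X) = ?G * X" if "X \<in> carrier_mat ?N ?N" for X
    using that by (simp add: hyperbolic_mat_mult flip: asc)
  have "cnj_mat (?U\<^sup>T) = ?U\<^sup>T" by (simp add: map_mat_transpose)
  then have "cnj_mat W * ?J = ?H * (?U\<^sup>T * (cnj_mat A * ?J))"
    using car by (simp add: W_def cnj_mat_mult[of _ ?N ?N _ ?N] hyperbolic_mat_cnj asc)
  \<comment> \<open>After \<open>U^T U\<close> cancels, \<open>H\<close> passes through
    \<open>J\<close> and turns the double inverse \<open>?G2\<close> into \<open>?G\<close>, which
    rebuilds \<open>W\<close>.\<close>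
  also have "\<dots> = ?J * W"
    unfolding AJ using car
    by (simp add: mult_cancel_left_inverse[OF UU Ut Uc] HJ HG2 W_def)
  finally obtain V where V: "V \<in> carrier_mat n n" "W = complexify V"
    using complexify_obtain[OF W] by blast
  have "A = ?U * ?H * W"
    using car by (simp add: W_def asc mult_cancel_left_inverse[OF HG(1)]
      mult_cancel_left_inverse[OF UU' Uc Ut])
  with V WW U show thesis
    by (intro that) (simp add: orthogonal_factorization_def quat_orthogonal_iff)
qed

section \<open>Existence of the canonical form\<close>

lemma canonical_form_exists:
  assumes M: "M \<in> carrier_mat (2 * n) (2 * n)"
    and skew: "ctranspose M = - M" and sq: "M * cnj_mat M = - 1\<^sub>m (2 * n)"
  obtains U \<theta> where "orthonormal_mat (2 * n) U"
    "M = map_mat complex_of_real U * canonical_mat n \<theta> * (map_mat complex_of_real U)\<^sup>T"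
proof -
  let ?N = "2 * n"
  note asc = assoc_mult_mat[of _ ?N ?N _ ?N _ ?N]
  \<comment> \<open>Multiplying the skew-Hermitian \<open>M\<close> by \<open>- \<i>\<close> gives a
    Hermitian matrix; its real eigenvalues \<open>\<mu> j\<close> correspond to eigenvalues
    \<open>\<i> \<mu> j\<close> of \<open>M\<close>.\<close>
  have "ctranspose ((- \<i>) \<cdot>\<^sub>m M) = (- \<i>) \<cdot>\<^sub>m M"
  proof (rule eq_matI)
    fix i j assume "i < dim_row ((- \<i>) \<cdot>\<^sub>m M)" "j < dim_col ((- \<i>) \<cdot>\<^sub>m M)"
    with M have ij: "i < ?N" "j < ?N" by auto
    then have "cnj (M $$ (j, i)) = - M $$ (i, j)"
      using arg_cong[OF skew, of "\<lambda>X. X $$ (i, j)"] M by simp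
    then show "ctranspose ((- \<i>) \<cdot>\<^sub>m M) $$ (i, j) = ((- \<i>) \<cdot>\<^sub>m M) $$ (i, j)"
      using ij M by simp
  qed (use M in auto)
  moreover have "(- \<i>) \<cdot>\<^sub>m M \<in> carrier_mat ?N ?N" using M by simp
  ultimately obtain Q \<mu> where Q: "Q \<in> carrier_mat ?N ?N" and QQ: "ctranspose Q * Q = 1\<^sub>m ?N"
    and KQ: "(- \<i>) \<cdot>\<^sub>m M * Q = Q * mat_diag ?N (\<lambda>i. complex_of_real (\<mu> i))"
    using hermitian_spectral by metis
  have MQ_entry: "(M * Q) $$ (i, j) = \<i> * \<mu> j * Q $$ (i, j)" if "i < ?N" "j < ?N" for i j
  proof -
    have "- \<i> * (M * Q) $$ (i, j) = Q $$ (i, j) * \<mu> j"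
      using arg_cong[OF KQ, of "\<lambda>X. X $$ (i, j)"] that M Q
      by (simp add: mat_diag_mult_right[OF Q])
    then have "\<i> * (- \<i> * (M * Q) $$ (i, j)) = \<i> * (Q $$ (i, j) * \<mu> j)" by simp
    then show ?thesis by (simp add: algebra_simps)
  qed
  have MQ: "M * Q = Q * mat_diag ?N (\<lambda>j. \<i> * \<mu> j)"
    by (rule eq_matI) (use M Q MQ_entry in \<open>auto simp: mat_diag_mult_right[OF Q] simp del: index_mult_mat(1)\<close>)
  \<comment> \<open>Conjugate \<open>M q = \<i> \<mu> q\<close>, apply \<open>M\<close> and use
    \<open>M cnj M = - 1\<close>. The factor \<open>\<mu> j\<close> stays on the left until it is
    known to be nonzero.\<close>
  have McQ_entry': "(M * cnj_mat Q) $$ (i, j) * (\<i> * \<mu> j) = cnj (Q $$ (i, j))"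
    if "i < ?N" "j < ?N" for i j
  proof -
    have "M * (cnj_mat M * cnj_mat Q) = - cnj_mat Q"
      using M Q sq by (simp flip: asc)
    moreover have "cnj_mat M * cnj_mat Q = cnj_mat (M * Q)"
      using M Q by (simp add: cnj_mat_mult[of _ ?N ?N _ ?N])
    moreover have "cnj_mat (M * Q) = cnj_mat Q * mat_diag ?N (\<lambda>j. - (\<i> * \<mu> j))"
      unfolding MQ using Q by (intro eq_matI) (auto simp: mat_diag_mult_right[of _ ?N])
    ultimately have "M * cnj_mat Q * mat_diag ?N (\<lambda>j. - (\<i> * \<mu> j)) = - cnj_mat Q"
      using M Q by (simp add: asc)
    from arg_cong[OF this, of "\<lambda>X. X $$ (i, j)"] show ?thesis
      using M Q that by (simp add: mat_diag_mult_right[of _ ?N] del: index_mult_mat(1))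
  qed
  \<comment> \<open>A zero \<open>\<mu> j\<close> would make column \<open>j\<close> of
    \<open>Q\<close> vanish, although it has length 1.\<close>
  have \<mu>0: "\<mu> j \<noteq> 0" if j: "j < ?N" for j
  proof
    assume "\<mu> j = 0"
    then have "Q $$ (i, j) = 0" if "i < ?N" for i
      using McQ_entry'[OF that j] by simp
    then have "(ctranspose Q * Q) $$ (j, j) = 0"
      using j Q by (simp add: scalar_prod_def)
    then show False using QQ j by simp
  qed
  have McQ_entry: "(M * cnj_mat Q) $$ (i, j) = - \<i> / \<mu> j * cnj (Q $$ (i, j))"
    if "i < ?N" "j < ?N" for i j
  proof -
    have "x = - \<i> / \<mu> j * (x * (\<i> * \<mu> j))" for x :: complex
      using \<mu>0[OF that(2)] by (simp add: field_simps)
    then show ?thesis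
      by (metis McQ_entry'[OF that])
  qed
  have McQ: "M * cnj_mat Q = cnj_mat Q * mat_diag ?N (\<lambda>j. - \<i> / \<mu> j)"
    by (rule eq_matI)
      (use M Q McQ_entry in \<open>auto simp: mat_diag_mult_right[of _ ?N] simp del: index_mult_mat(1)\<close>)

  text \<open>Conjugation maps eigenvectors of \<open>M\<close> for \<open>\<i> \<mu>\<close> to eigenvectors for \<open>- \<i> / \<mu>\<close>, so
    exactly half of the \<open>\<mu> j\<close> are positive.\<close>
  have "Q\<^sup>T * cnj_mat Q = cnj_mat (ctranspose Q * Q)"
    using Q by (simp add: cnj_mat_mult[of _ ?N ?N _ ?N])
  then have cQQ: "Q\<^sup>T * cnj_mat Q = 1\<^sub>m ?N" using QQ by simp
  have "proots (char_poly M) = image_mset (\<lambda>j. \<i> * \<mu> j) (mset_set {..<?N})"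
    by (rule proots_char_poly_diagonalized[OF M Q _ QQ MQ]) (use Q in auto)
  moreover have "proots (char_poly M) = image_mset (\<lambda>j. - \<i> / \<mu> j) (mset_set {..<?N})"
    by (rule proots_char_poly_diagonalized[OF M _ _ cQQ McQ]) (use Q in auto)
  ultimately have "image_mset (\<lambda>j. \<i> * \<mu> j) (mset_set {..<?N}) = image_mset (\<lambda>j. - \<i> / \<mu> j) (mset_set {..<?N})"
    by simp
  \<comment> \<open>The imaginary part of \<open>- \<i> / \<mu> j\<close> is positive exactly when
    \<open>\<mu> j\<close> is negative.\<close>
  from arg_cong[OF this, of "\<lambda>X. size (filter_mset (\<lambda>z. Im z > 0) X)"]
  have "card {j \<in> {..<?N}. \<mu> j > 0} = card {j \<in> {..<?N}. \<mu> j < 0}"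
    by (simp add: filter_mset_image_mset filter_mset_mset_set)
  moreover have "?N = card {j \<in> {..<?N}. \<mu> j > 0} + card {j \<in> {..<?N}. \<mu> j < 0}"
  proof -
    have "{..<?N} \<subseteq> {j \<in> {..<?N}. \<mu> j > 0} \<union> {j \<in> {..<?N}. \<mu> j < 0}"
    proof
      fix j assume "j \<in> {..<?N}"
      then show "j \<in> {j \<in> {..<?N}. \<mu> j > 0} \<union> {j \<in> {..<?N}. \<mu> j < 0}"
        using linorder_cases[of "\<mu> j" 0] \<mu>0[of j] by blast
    qed
    then have "{j \<in> {..<?N}. \<mu> j > 0} \<union> {j \<in> {..<?N}. \<mu> j < 0} = {..<?N}" by blast
    moreover have "{j \<in> {..<?N}. \<mu> j > 0} \<inter> {j \<in> {..<?N}. \<mu> j < 0} = {}" by auto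
    ultimately show ?thesis
      using card_Un_disjoint[of "{j \<in> {..<?N}. \<mu> j > 0}" "{j \<in> {..<?N}. \<mu> j < 0}"] by simp
  qed
  ultimately have "card {j \<in> {..<?N}. \<mu> j > 0} = n" by simp
  then obtain f where f: "bij_betw f {0..<n} {j \<in> {..<?N}. \<mu> j > 0}"
    using ex_bij_betw_nat_finite[of "{j \<in> {..<?N}. \<mu> j > 0}"] by auto
  then have fN: "f j < ?N" and fpos: "\<mu> (f j) > 0" if "j < n" for j
    using that by (auto dest: bij_betwE)
  have finj: "f a = f b \<longleftrightarrow> a = b" if "a < n" "b < n" for a b
    using bij_betw_imp_inj_on[OF f] that by (auto dest: inj_onD)

  \<comment> \<open>The chosen eigenvectors are orthogonal to all their conjugates. Since
    \<open>M^T M = 1\<close>, the bilinear product \<open>x^T y\<close> is unchanged by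
    \<open>M\<close>, while on two eigenvectors it is multiplied by \<open>- \<mu> \<mu>'\<close>;
    as \<open>1 + \<mu> \<mu>' > 0\<close>, the product is 0.\<close>
  have QtQ: "(Q\<^sup>T * Q) $$ (f a, f b) = 0" if "a < n" "b < n" for a b
  proof -
    have Mt_eq: "M\<^sup>T = - cnj_mat M"
    proof (rule eq_matI)
      fix i j assume "i < dim_row (- cnj_mat M)" "j < dim_col (- cnj_mat M)"
      then show "M\<^sup>T $$ (i, j) = (- cnj_mat M) $$ (i, j)"
        using arg_cong[OF arg_cong[OF skew, of cnj_mat], of "\<lambda>X. X $$ (i, j)"] M by simp
    qed (use M in auto)
    have "cnj_mat (- 1\<^sub>m ?N) = - 1\<^sub>m ?N"
      by (rule eq_matI) auto
    then have "cnj_mat M * M = - 1\<^sub>m ?N"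
      using arg_cong[OF sq, of cnj_mat] cnj_mat_mult[OF M, of "cnj_mat M" ?N] M by simp
    then have MtM: "M\<^sup>T * M = 1\<^sub>m ?N"
      using uminus_mult_left_mat[of "cnj_mat M" M] M by (simp add: Mt_eq)
    have Mt: "M\<^sup>T \<in> carrier_mat ?N ?N" using M by simp
    have Qt: "Q\<^sup>T \<in> carrier_mat ?N ?N" and MQc: "M * Q \<in> carrier_mat ?N ?N" using M Q by auto
    have "Q\<^sup>T * Q = Q\<^sup>T * (M\<^sup>T * (M * Q))"
      by (simp only: mult_cancel_left_inverse[OF MtM Mt M Q])
    also have "\<dots> = (M * Q)\<^sup>T * (M * Q)"
      by (simp only: transpose_mult[OF M Q] assoc_mult_mat[OF Qt Mt MQc])
    finally have "(Q\<^sup>T * Q) $$ (f a, f b) = (\<Sum>k<?N. (M * Q) $$ (k, f a) * (M * Q) $$ (k, f b))"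
      using M Q fN that by (simp add: scalar_prod_def lessThan_atLeast0)
    also have "\<dots> = (\<Sum>k<?N. - (\<mu> (f a) * \<mu> (f b)) * (Q $$ (k, f a) * Q $$ (k, f b)))"
      using fN that by (intro sum.cong) (auto simp: MQ_entry algebra_simps simp del: index_mult_mat(1))
    also have "\<dots> = - (\<mu> (f a) * \<mu> (f b)) * (Q\<^sup>T * Q) $$ (f a, f b)"
      using Q fN that by (simp add: scalar_prod_def lessThan_atLeast0 sum_distrib_left)
    finally have "(Q\<^sup>T * Q) $$ (f a, f b) = - (\<mu> (f a) * \<mu> (f b)) * (Q\<^sup>T * Q) $$ (f a, f b)" .
    moreover have "(1 + c) * x = 0" if "x = - c * x" for c x :: complex
      using that by (simp add: distrib_right eq_neg_iff_add_eq_0)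
    ultimately have "complex_of_real (1 + \<mu> (f a) * \<mu> (f b)) * (Q\<^sup>T * Q) $$ (f a, f b) = 0"
      by (simp del: index_mult_mat(1))
    moreover have "1 + \<mu> (f a) * \<mu> (f b) > 0"
      using fpos that by (simp add: add_pos_pos)
    then have "complex_of_real (1 + \<mu> (f a) * \<mu> (f b)) \<noteq> 0"
      unfolding of_real_eq_0_iff by simp
    ultimately show ?thesis by (metis mult_eq_0_iff)
  qed

  \<comment> \<open>The columns of \<open>W\<close> are the eigenvectors with
    \<open>\<mu> > 0\<close> followed by their conjugates. Cutting them into an upper part
    \<open>X\<close> and a lower part \<open>Y\<close> makes conjugation of \<open>W\<close> a swap
    of block columns.\<close>
  define X where "X = mat n n (\<lambda>(i, j). Q $$ (i, f j))"
  define Y where "Y = mat n n (\<lambda>(i, j). Q $$ (i + n, f j))"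
  define W where "W = four_block_mat X (cnj_mat X) Y (cnj_mat Y)"
  have XY: "X \<in> carrier_mat n n" "Y \<in> carrier_mat n n" by (simp_all add: X_def Y_def)
  then have W: "W \<in> carrier_mat ?N ?N"
    unfolding W_def mult_2 by (intro four_block_carrier_mat) auto
  have Wentry: "W $$ (i, j) = (if j < n then Q $$ (i, f j) else cnj (Q $$ (i, f (j - n))))"
    if "i < ?N" "j < ?N" for i j
    using that by (auto simp: W_def X_def Y_def)
  have "ctranspose W * W = 1\<^sub>m ?N"
  proof (rule eq_matI)
    fix i j assume "i < dim_row (1\<^sub>m ?N :: complex mat)" "j < dim_col (1\<^sub>m ?N :: complex mat)"
    then have ij: "i < ?N" "j < ?N" by auto
    have sum: "(ctranspose W * W) $$ (i, j) = (\<Sum>k<?N. cnj (W $$ (k, i)) * W $$ (k, j))"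
      using ij W by (simp add: scalar_prod_def lessThan_atLeast0)
    have QQ': "(\<Sum>k<?N. cnj (Q $$ (k, f a)) * Q $$ (k, f b)) = (if a = b then 1 else 0)"
      if "a < n" "b < n" for a b
    proof -
      have "(\<Sum>k<?N. cnj (Q $$ (k, f a)) * Q $$ (k, f b)) = (ctranspose Q * Q) $$ (f a, f b)"
        using fN that Q by (simp add: scalar_prod_def lessThan_atLeast0)
      then show ?thesis
        using fN that finj by (simp add: QQ)
    qed
    have QtQ': "(\<Sum>k<?N. Q $$ (k, f a) * Q $$ (k, f b)) = 0" if "a < n" "b < n" for a b
      using QtQ[OF that] fN that Q by (simp add: scalar_prod_def lessThan_atLeast0)
    have cnj1: "(\<Sum>k<?N. cnj (Q $$ (k, f a)) * cnj (Q $$ (k, f b))) = 0" if "a < n" "b < n" for a b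
      using arg_cong[OF QtQ'[OF that], of cnj] by simp
    have cnj2: "(\<Sum>k<?N. Q $$ (k, f a) * cnj (Q $$ (k, f b))) = (if a = b then 1 else 0)"
      if "a < n" "b < n" for a b
      using arg_cong[OF QQ'[OF that], of cnj] by (simp split: if_splits)
    have "(ctranspose W * W) $$ (i, j) = (if i = j then 1 else 0)"
    \<comment> \<open>The diagonal blocks come from orthonormality of the columns of
      \<open>Q\<close>, the mixed blocks from \<open>QtQ\<close>.\<close>
    proof (cases "i < n"; cases "j < n")
      assume "i < n" "j < n"
      then show ?thesis unfolding sum using ij QQ'[of i j] by (simp add: Wentry)
    next
      assume "i < n" "\<not> j < n"
      then show ?thesis unfolding sum using ij cnj1[of i "j - n"] by (auto simp: Wentry)
    next
      assume "\<not> i < n" "j < n"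
      then show ?thesis unfolding sum using ij QtQ'[of "i - n" j] by (auto simp: Wentry)
    next
      assume "\<not> i < n" "\<not> j < n"
      then have "i - n < n" "j - n < n" "i - n = j - n \<longleftrightarrow> i = j" using ij by auto
      then show ?thesis unfolding sum using \<open>\<not> i < n\<close> \<open>\<not> j < n\<close> ij cnj2[of "i - n" "j - n"]
        by (simp add: Wentry)
    qed
    then show "(ctranspose W * W) $$ (i, j) = 1\<^sub>m ?N $$ (i, j)"
      using ij by (simp del: index_mult_mat(1))
  qed (use W in auto)
  note WW = this

  \<comment> \<open>Chosen so that \<open>exp (2 * \<theta> j) = \<mu> (f j)\<close>, which matches
    \<open>canonical_eigenvalue\<close> on both halves of the columns of \<open>W\<close>.\<close>
  define \<theta> where "\<theta> = (\<lambda>j. ln (\<mu> (f j)) / 2)"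
  let ?D = "mat_diag ?N (canonical_eigenvalue n \<theta>)"
  have MW: "M * W = W * ?D"
  proof (rule eq_matI)
    fix i j assume "i < dim_row (W * ?D)" "j < dim_col (W * ?D)"
    then have ij: "i < ?N" "j < ?N" using W by (auto simp: mat_diag_def)
    have "(M * W) $$ (i, j) = (\<Sum>k<?N. M $$ (i, k) * W $$ (k, j))"
      using ij M W by (simp add: scalar_prod_def lessThan_atLeast0)
    also have "\<dots> = (if j < n then (M * Q) $$ (i, f j) else (M * cnj_mat Q) $$ (i, f (j - n)))"
      using ij M Q fN[of j] fN[of "j - n"]
      by (auto simp: Wentry scalar_prod_def lessThan_atLeast0)
    also have "\<dots> = W $$ (i, j) * canonical_eigenvalue n \<theta> j"
      using ij fN[of j] fN[of "j - n"] fpos[of j] fpos[of "j - n"]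
      by (auto simp: MQ_entry McQ_entry Wentry canonical_eigenvalue_def \<theta>_def exp_minus field_simps
          simp del: index_mult_mat(1) of_real_exp)
    finally show "(M * W) $$ (i, j) = (W * ?D) $$ (i, j)"
      using ij by (simp add: mat_diag_mult_right[OF W])
  qed (use M W in \<open>auto simp: mat_diag_def\<close>)

  let ?C = "cayley_mat n"
  define R where "R = W * ?C"
  have R: "R \<in> carrier_mat ?N ?N" using W by (simp add: R_def)
  \<comment> \<open>The swap of the two halves. Conjugation swaps the block columns of
    \<open>W\<close> and the block rows of \<open>cayley_mat\<close>; in the product
    \<open>R\<close> the swaps cancel, so \<open>R\<close> is real.\<close>
  let ?S = "diag_blocks n (\<lambda>_. 0) (\<lambda>_. 1) (\<lambda>_. 1) (\<lambda>_. 0) :: complex mat"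
  have "cnj_mat W = W * ?S"
  proof -
    have [simp]: "mat_diag n (\<lambda>_. 0) = (0\<^sub>m n n :: complex mat)" by (rule eq_matI) (auto simp: mat_diag_def)
    have "W * ?S = four_block_mat (cnj_mat X) X (cnj_mat Y) Y"
      unfolding W_def diag_blocks_def
      by (subst mult_four_block_mat[where ?nr1.0 = n and ?nr2.0 = n and ?n1.0 = n and ?n2.0 = n
        and ?nc1.0 = n and ?nc2.0 = n]) (use XY in auto)
    moreover have "cnj_mat W = four_block_mat (cnj_mat X) (cnj_mat (cnj_mat X)) (cnj_mat Y) (cnj_mat (cnj_mat Y))"
      unfolding W_def using XY by (intro map_four_block_mat) auto
    ultimately show ?thesis by simp
  qed
  moreover have "?S * cnj_mat ?C = ?C"
    unfolding cayley_mat_def Let_def diag_blocks_cnj diag_blocks_mult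
    by (rule diag_blocks_cong) simp
  ultimately have Rreal: "cnj_mat R = R"
    unfolding R_def using W by (simp add: cnj_mat_mult[of _ ?N ?N _ ?N] asc)
  then obtain U where U: "R = map_mat complex_of_real U" by (rule real_mat_obtain)
  have Cc: "?C \<in> carrier_mat ?N ?N" by simp
  have Wt: "ctranspose W \<in> carrier_mat ?N ?N" using W by simp
  have "ctranspose R * R = ctranspose ?C * (ctranspose W * (W * ?C))"
    using W by (simp add: R_def transpose_mult[of _ ?N ?N _ ?N] cnj_mat_mult[of _ ?N ?N _ ?N] asc)
  also have "\<dots> = 1\<^sub>m ?N"
    using mult_cancel_left_inverse[OF WW Wt W Cc] cayley_mat_unitary by simp
  finally have RR: "R\<^sup>T * R = 1\<^sub>m ?N"
    using Rreal by (simp flip: map_mat_transpose)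
  have Rt: "R\<^sup>T \<in> carrier_mat ?N ?N" using R by simp
  have RR': "R * R\<^sup>T = 1\<^sub>m ?N"
    using mat_mult_left_right_inverse[OF Rt R RR] .
  \<comment> \<open>\<open>M W C = W D C = W C canonical_mat\<close>, with \<open>C\<close> the
    matrix \<open>cayley_mat n\<close> and \<open>D\<close> the diagonal matrix of
    eigenvalues.\<close>
  have "M * R = R * canonical_mat n \<theta>"
    using M W MW by (simp add: R_def asc cayley_mat_canonical_mat flip: assoc_mult_mat[OF M W Cc])
  then have "R * canonical_mat n \<theta> * R\<^sup>T = M * R * R\<^sup>T" by simp
  also have "\<dots> = M"
    using M R RR' by (simp add: asc right_mult_one_mat[of _ ?N ?N])
  finally have "M = R * canonical_mat n \<theta> * R\<^sup>T" ..
  moreover have "orthonormal_mat ?N U"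
  proof -
    have Uc: "U \<in> carrier_mat ?N ?N" using R by (simp add: U)
    then have "map_mat complex_of_real (U\<^sup>T * U) = map_mat complex_of_real (1\<^sub>m ?N)"
      using RR of_real_mat_mult[of "U\<^sup>T" ?N ?N U ?N]
      by (simp add: U map_mat_transpose of_real_hom.mat_hom_one)
    then show ?thesis
      using Uc of_real_hom.mat_hom_inj by (auto simp: orthonormal_mat_def)
  qed
  ultimately show thesis
    using that unfolding U by blast
qed

section \<open>Existence of the factorization and uniqueness of its angles\<close>

theorem theorem8p6:
  fixes n :: nat and A :: "complex mat"
  assumes "orthonormal_mat (2 * n) A"
  shows "\<exists>\<theta> :: nat \<Rightarrow> real.
           (\<exists>U V. orthogonal_factorization n A U \<theta> V) \<and>
           (\<forall>\<theta>' :: nat \<Rightarrow> real. (\<exists>U' V'. orthogonal_factorization n A U' \<theta>' V') \<longrightarrow>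
              (\<exists>p \<epsilon>. p permutes {..<n} \<and>
                 (\<forall>m<n. \<epsilon> m \<in> {1, - 1 :: real} \<and> \<theta>' m = \<epsilon> m * \<theta> (p m))))"
proof -
  let ?N = "2 * n" and ?J = "sympl_mat n"
  note asc = assoc_mult_mat[of _ ?N ?N _ ?N _ ?N]
  define M where "M = cnj_mat A * ?J * A\<^sup>T"
  from assms have A: "A \<in> carrier_mat ?N ?N" "A\<^sup>T \<in> carrier_mat ?N ?N" and AA: "A\<^sup>T * A = 1\<^sub>m ?N"
    by (auto simp: orthonormal_mat_def)
  have M: "M \<in> carrier_mat ?N ?N" using A by (simp add: M_def)
  have "?J * ?J = diag_blocks n (\<lambda>_. - 1) (\<lambda>_. 0) (\<lambda>_. 0) (\<lambda>_. - 1)"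
    by (simp add: sympl_mat_def diag_blocks_mult)
  also have "\<dots> = - 1\<^sub>m ?N"
    by (rule eq_matI) (auto simp: diag_blocks_def mat_diag_def)
  finally have JJ: "?J * ?J = - 1\<^sub>m ?N" .
  have cAA: "ctranspose A * cnj_mat A = 1\<^sub>m ?N"
    using arg_cong[OF AA, of cnj_mat] A by (simp add: cnj_mat_mult[of _ ?N ?N _ ?N])
  have cA: "cnj_mat A \<in> carrier_mat ?N ?N" "ctranspose A \<in> carrier_mat ?N ?N" using A by auto
  have AA': "A * A\<^sup>T = 1\<^sub>m ?N" and cAA': "cnj_mat A * ctranspose A = 1\<^sub>m ?N"
    using mat_mult_left_right_inverse[OF A(2,1) AA] mat_mult_left_right_inverse[OF cA(2,1) cAA] .
  have cJ: "cnj_mat (?J\<^sup>T) = - ?J"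
    by (subst map_mat_transpose[symmetric]) (simp only: sympl_mat_cnj sympl_mat_transpose)
  \<comment> \<open>Conjugate transposition exchanges the outer factors \<open>cnj A\<close> and
    \<open>A^T\<close> with each other and negates \<open>J\<close>.\<close>
  have skew: "ctranspose M = - M"
    using A carrier_matD[OF sympl_mat_carrier[of n]] uminus_mult_left_mat[of ?J "A\<^sup>T"]
      uminus_mult_right_mat[of "cnj_mat A" "?J * A\<^sup>T"]
    by (simp add: M_def transpose_mult[of _ ?N ?N _ ?N] cnj_mat_mult[of _ ?N ?N _ ?N] asc
        map_mat_transpose cJ)
  \<comment> \<open>In the middle \<open>A^T A\<close> cancels, then \<open>J J = - 1\<close>, and
    the outer factors are inverse to each other.\<close>
  have "M * cnj_mat M = cnj_mat A * (?J * (A\<^sup>T * (A * (?J * ctranspose A))))"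
    using A by (simp add: M_def cnj_mat_mult[of _ ?N ?N _ ?N] sympl_mat_cnj asc)
  also have "\<dots> = cnj_mat A * (?J * ?J * ctranspose A)"
    using A by (simp add: mult_cancel_left_inverse[OF AA] asc)
  also have "\<dots> = - 1\<^sub>m ?N"
    using A cA cAA' by (simp add: JJ)
  finally have sq: "M * cnj_mat M = - 1\<^sub>m ?N" .
  obtain U \<theta> where U: "orthonormal_mat ?N U"
    and can: "M = map_mat complex_of_real U * canonical_mat n \<theta> * (map_mat complex_of_real U)\<^sup>T"
    using canonical_form_exists[OF M skew sq] by blast
  obtain V where V: "orthogonal_factorization n A U \<theta> V"
    using canonical_imp_factorization[OF assms U can[unfolded M_def]] by blast
  \<comment> \<open>\<open>M\<close> is built from \<open>A\<close> alone, so every factorization of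
    \<open>A\<close> describes the same multiset of roots through its own angles.\<close>
  have proots: "proots (char_poly M) = image_mset (canonical_eigenvalue n \<phi>) (mset_set {..<?N})"
    if fac: "orthogonal_factorization n A U' \<phi> V'" for U' \<phi> V'
  proof (rule proots_char_poly_canonical[OF M])
    show "M = map_mat complex_of_real U' * canonical_mat n \<phi> * (map_mat complex_of_real U')\<^sup>T"
      unfolding M_def by (rule factorization_imp_canonical[OF fac])
    have U': "U' \<in> carrier_mat ?N ?N" "U'\<^sup>T * U' = 1\<^sub>m ?N"
      using fac by (auto simp: orthogonal_factorization_def orthonormal_mat_def)
    then show "map_mat complex_of_real U' \<in> carrier_mat ?N ?N" by simp
    show "(map_mat complex_of_real U')\<^sup>T * map_mat complex_of_real U' = 1\<^sub>m ?N"
      using of_real_mat_mult[of "U'\<^sup>T" ?N ?N U' ?N] U'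
      by (simp add: map_mat_transpose of_real_hom.mat_hom_one)
  qed
  have "\<exists>p \<epsilon>. p permutes {..<n} \<and> (\<forall>m<n. \<epsilon> m \<in> {1, - 1 :: real} \<and> \<theta>' m = \<epsilon> m * \<theta> (p m))"
    if fac: "orthogonal_factorization n A U' \<theta>' V'" for U' \<theta>' V'
  proof -
    obtain p where "p permutes {..<n}" "\<forall>m<n. \<theta>' m = \<theta> (p m)"
      using canonical_mat_angles_unique proots[OF fac] proots[OF V] by metis
    then show ?thesis
      \<comment> \<open>The signs are constantly 1, since the eigenvalue
        \<open>\<i> exp (2 \<theta>)\<close> already determines the sign of
        \<open>\<theta>\<close>.\<close>
      by (intro exI[of _ p] exI[of _ "\<lambda>_. 1"]) simp
  qed
  with V show ?thesis by blast
qed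

end
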